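(* For every positive integer $n$, $\sigma\overline{\mathrm{mex}}(n)$ is even, where $\sigma\overline{\mathrm{mex}}(n)=\sum_{\pi}\overline{\mathrm{mex}}(\pi)$, the sum being over all overpartitions $\pi$ of $n$.
   Context: An overpartition of a positive integer $n$ is a non-increasing sequence of positive integers summing to $n$ in which the first occurrence of each number may (or may not) be overlined. For an overpartition $\pi$, $\overline{\mathrm{mex}}(\pi)$ is the smallest positive integer that does not occur as a part of $\pi$, whether overlined or non-overlined. *)

theory Defs
  imports Main
begin

(* A part is a pair (k, b): k is its size and b tells whether it is overlined.
   The last conjunct allows only the first occurrence of each size to be overlined. *)
definition overpartition :: "nat \<Rightarrow> (nat \<times> bool) list \<Rightarrow> bool" where
  "overpartition n \<pi> \<longleftrightarrow>
     sorted_wrt (\<ge>) (map fst \<pi>) \<and>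
     (\<forall>k \<in> set (map fst \<pi>). k > 0) \<and>
     sum_list (map fst \<pi>) = n \<and>
     (\<forall>i < length \<pi>. snd (\<pi> ! i) \<longrightarrow> (\<forall>j < i. fst (\<pi> ! j) \<noteq> fst (\<pi> ! i)))"

definition overpartitions :: "nat \<Rightarrow> (nat \<times> bool) list set" where
  "overpartitions n = {\<pi>. overpartition n \<pi>}"

definition omex :: "(nat \<times> bool) list \<Rightarrow> nat" where
  "omex \<pi> = (LEAST m. m > 0 \<and> m \<notin> set (map fst \<pi>))"

definition sigma_omex :: "nat \<Rightarrow> nat" where
  "sigma_omex n = (\<Sum>\<pi> \<in> overpartitions n. omex \<pi>)"

(* The sum in sigma_omex is a genuine finite sum. *)
lemma finite_overpartitions: "finite (overpartitions n)"
proof (rule finite_subset)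
  show "overpartitions n \<subseteq> {xs. set xs \<subseteq> {..n} \<times> UNIV \<and> length xs \<le> n}"
  proof
    fix \<pi> assume "\<pi> \<in> overpartitions n"
    then have pos: "\<forall>k \<in> set (map fst \<pi>). k > 0" and s: "sum_list (map fst \<pi>) = n"
      by (auto simp: overpartitions_def overpartition_def)
    have "set \<pi> \<subseteq> {..n} \<times> UNIV"
    proof
      fix p assume "p \<in> set \<pi>"
      then have "fst p \<in> set (map fst \<pi>)" by simp
      then have "fst p \<le> n" using member_le_sum_list s by blast
      then show "p \<in> {..n} \<times> UNIV" by (cases p) simp
    qed
    moreover have "length xs \<le> sum_list xs" if "\<forall>k \<in> set xs. k > 0" for xs :: "nat list"
      using that by (induction xs) auto
    from this[OF pos] have "length \<pi> \<le> n" using s by simp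
    ultimately show "\<pi> \<in> {xs. set xs \<subseteq> {..n} \<times> UNIV \<and> length xs \<le> n}" by simp
  qed
  show "finite {xs :: (nat \<times> bool) list. set xs \<subseteq> {..n} \<times> UNIV \<and> length xs \<le> n}"
    by (rule finite_lists_length_le) simp
qed

end

(* Since n > 0, every overpartition of n has a largest part, and its first occurrence may
   freely be overlined or not. Switching this overline is a fixed-point-free involution
   that leaves the mex unchanged, so each value of the mex is counted twice. *)
theory Submission
  imports Defs
begin

text \<open>Parts are non-increasing, so index 0 is the first occurrence of the largest part. A list
  update leaves \<open>[]\<close> unchanged, so the involution law needs no side condition.\<close>

definition toggle_hd :: "(nat \<times> bool) list \<Rightarrow> (nat \<times> bool) list" where
  "toggle_hd \<pi> = \<pi>[0 := apsnd Not (\<pi> ! 0)]"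

lemma toggle_hd_simps [simp]:
  "toggle_hd [] = []"
  "toggle_hd (p # \<pi>) = apsnd Not p # \<pi>"
  by (simp_all add: toggle_hd_def)

lemma toggle_hd_involutive [simp]: "toggle_hd (toggle_hd \<pi>) = \<pi>"
  by (cases \<pi>) auto

lemma map_fst_toggle_hd [simp]: "map fst (toggle_hd \<pi>) = map fst \<pi>"
  by (cases \<pi>) auto

lemma snd_hd_toggle_hd: "\<pi> \<noteq> [] \<Longrightarrow> snd (hd (toggle_hd \<pi>)) \<longleftrightarrow> \<not> snd (hd \<pi>)"
  by (cases \<pi>) auto

lemma omex_toggle_hd: "omex (toggle_hd \<pi>) = omex \<pi>"
  by (simp only: omex_def map_fst_toggle_hd)

text \<open>Sizes stay the same and only the flag at index 0 can change, where the overlining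
  condition is vacuous because no index precedes it.\<close>

lemma overpartition_toggle_hd:
  assumes "overpartition n \<pi>"
  shows "overpartition n (toggle_hd \<pi>)"
proof -
  have len: "length (toggle_hd \<pi>) = length \<pi>"
    by (simp add: toggle_hd_def)
  have fst_nth: "fst (toggle_hd \<pi> ! i) = fst (\<pi> ! i)" if "i < length \<pi>" for i
    using that by (cases \<pi>; cases i) auto
  have snd_nth: "snd (toggle_hd \<pi> ! i) = snd (\<pi> ! i)" if "i > 0" for i
    using that by (simp add: toggle_hd_def)
  have "fst (toggle_hd \<pi> ! j) \<noteq> fst (toggle_hd \<pi> ! i)"
    if "i < length \<pi>" "snd (toggle_hd \<pi> ! i)" "j < i" for i j
    using that assms fst_nth[of i] fst_nth[of j] snd_nth[of i]
    by (auto simp: overpartition_def)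
  with assms show ?thesis
    unfolding overpartition_def map_fst_toggle_hd len by blast
qed

lemma overpartition_nonempty: "overpartition n \<pi> \<Longrightarrow> n > 0 \<Longrightarrow> \<pi> \<noteq> []"
  by (auto simp: overpartition_def)

theorem theorem1p6:
  fixes n :: nat
  assumes "n > 0"
  shows "even (sigma_omex n)"
proof -
  let ?A = "{\<pi> \<in> overpartitions n. snd (hd \<pi>)}"
  let ?B = "{\<pi> \<in> overpartitions n. \<not> snd (hd \<pi>)}"
  have "sigma_omex n = sum omex (?A \<union> ?B)"
    unfolding sigma_omex_def by (rule sum.cong) auto
  \<comment> \<open>\<open>toggle_hd\<close> is its own inverse, so it serves as both witnesses of
    the bijection. Positivity of \<open>n\<close> excludes \<open>[]\<close>, which has no overline
    to switch.\<close>
  also have "\<dots> = sum omex ?A + sum omex ?B"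
    by (rule sum.union_disjoint) (auto simp: finite_overpartitions)
  also have "sum omex ?B = sum omex ?A"
    using overpartition_nonempty[OF _ assms]
    by (intro sum.reindex_bij_witness[of _ toggle_hd toggle_hd])
      (auto simp: overpartitions_def overpartition_toggle_hd snd_hd_toggle_hd omex_toggle_hd)
  finally show ?thesis
    by simp
qed

end
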